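(* Let $\mathcal{P}$ be a filtered poset, and let $B\colon \mathcal{P}\to\mathbb{N}$ be its associated labelling function. Given a unital commutative ring $R$ and a functor $F\colon\mathcal{P}^{\mathrm{op}}\to R\text{-Mod}$, we have $$H^k(\mathcal{P};F)=0$$ for every $k>\sup B$.
   Context: A poset $\mathcal{P}$ is viewed as a category with a unique arrow $p\to q$ iff $p\le q$. It is filtered if there is a strictly order-preserving map $d\colon\mathcal{P}\to\mathbb{N}$; one always takes $d(p)$ (the degree of $p$) to be the maximum length $n$ of a chain $p_0<p_1<\dots<p_n=p$ ending at $p$. Write $\mathcal{P}_{<p}=\{q\in\mathcal{P}\mid q<p\}$. $H^k(\mathcal{P};F)=\mathrm{R}^k\lim(F)$ denotes the $k$-th right derived functor of $\lim\colon\mathrm{Fun}(\mathcal{P}^{\mathrm{op}},R\text{-Mod})\to R\text{-Mod}$. For $p\in\mathcal{P}$ and a subposet $S\subseteq\mathcal{P}_{<p}$, $p$ closes a circuit in $S$ if some connected component of $S$ has at least two maximal elements. The labelling function $B\colon\mathcal{P}\to\mathbb{N}$ is defined inductively on the degree: $B(p)=0$ if $d(p)=0$, $B(p)=1$ if $d(p)=1$. For $p$ of degree $n\geq 2$, let $m=\max\{B(q)\mid q<p\}$ and $\mathcal{B}_p=\{s\in\mathcal{P}_{<p}\mid m-1\le B(s)\le m\}$; then $B(p)=m+1$ if $p$ closes a circuit in $\mathcal{B}_p$, and $B(p)=m$ otherwise. *)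

theory Defs
  imports "HOL-Algebra.AbelCoset" "HOL-Algebra.Module" "HOL-Library.Extended_Nat"
begin

section \<open>Filtered posets and the labelling function\<close>

text \<open>
  A poset is a subset \<open>P\<close> of an ordered type, with the induced order; in particular it may be
  empty.
\<close>

definition filtered :: "'p::order set \<Rightarrow> bool" where
  "filtered P \<longleftrightarrow> (\<exists>d :: 'p \<Rightarrow> nat. strict_mono_on P d)"

definition chain_lengths :: "'p::order set \<Rightarrow> 'p \<Rightarrow> nat set" where
  "chain_lengths P p =
     {n. \<exists>c :: nat \<Rightarrow> 'p. c ` {..n} \<subseteq> P \<and> strict_mono_on {..n} c \<and> c n = p}"

definition degree :: "'p::order set \<Rightarrow> 'p \<Rightarrow> nat" where
  "degree P p = Max (chain_lengths P p)"

definition poset_components :: "'p::order set \<Rightarrow> 'p set set" where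
  "poset_components S = S // {(x, y). x \<in> S \<and> y \<in> S \<and> (x \<le> y \<or> y \<le> x)}\<^sup>+"

definition maximal_elements :: "'p::order set \<Rightarrow> 'p set" where
  "maximal_elements C = {x \<in> C. \<forall>y\<in>C. \<not> x < y}"

definition closes_circuit :: "'p::order \<Rightarrow> 'p set \<Rightarrow> bool" where
  "closes_circuit p S \<longleftrightarrow> S \<subseteq> {..<p} \<and>
     (\<exists>C \<in> poset_components S. \<exists>x \<in> maximal_elements C. \<exists>y \<in> maximal_elements C. x \<noteq> y)"

text \<open>
  The conjunct \<open>degree P q < degree P p\<close> only serves to make the recursion terminate for arbitrary
  \<open>P\<close>; it is redundant for filtered posets, see \<open>labelling_filtered\<close> below. In that case
  \<open>labelling P q \<le> degree P q\<close>, so the maximum is taken over a finite set even if there are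
  infinitely many elements below \<open>p\<close>.
\<close>

function labelling :: "'p::order set \<Rightarrow> 'p \<Rightarrow> nat" where
  "labelling P p =
     (if degree P p = 0 then 0
      else if degree P p = 1 then 1
      else let Q = {q \<in> P. q < p \<and> degree P q < degree P p};
               L = (\<lambda>q. (q, labelling P q)) ` Q;
               m = Max (snd ` L);
               S = fst ` {(s, b) \<in> L. m - 1 \<le> b \<and> b \<le> m}
           in if closes_circuit p S then m + 1 else m)"
  by pat_completeness auto
termination
  by (relation "measure (\<lambda>(P, p). degree P p)") auto

declare labelling.simps [simp del]

lemma chain_lengths_finite:
  assumes "filtered P"
  shows "finite (chain_lengths P p)"
proof -
  obtain d :: "'a \<Rightarrow> nat" where d: "strict_mono_on P d"
    using assms by (auto simp: filtered_def)
  have "n \<le> d p" if "n \<in> chain_lengths P p" for n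
  proof -
    from that obtain c where c: "c ` {..n} \<subseteq> P" "strict_mono_on {..n} c" "c n = p"
      by (auto simp: chain_lengths_def)
    have "i \<le> d (c i)" if "i \<le> n" for i
      using that
    proof (induction i)
      case (Suc i)
      have "c i < c (Suc i)"
        using Suc.prems by (intro strict_mono_onD[OF c(2)]) auto
      moreover have "c i \<in> P" "c (Suc i) \<in> P"
        using Suc.prems c(1) by auto
      ultimately have "d (c i) < d (c (Suc i))"
        using strict_mono_onD[OF d] by blast
      then show ?case using Suc by simp
    qed simp
    then show ?thesis using c(3) by blast
  qed
  then have "chain_lengths P p \<subseteq> {..d p}" by auto
  then show ?thesis by (rule finite_subset) simp
qed

lemma degree_less:
  assumes "filtered P" "q \<in> P" "p \<in> P" "q < p"
  shows "degree P q < degree P p"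
proof -
  have "0 \<in> chain_lengths P q"
    using assms(2) by (auto simp: chain_lengths_def monotone_on_def intro!: exI[of _ "\<lambda>_. q"])
  then have "degree P q \<in> chain_lengths P q"
    using Max_in[OF chain_lengths_finite[OF assms(1)]] unfolding degree_def by blast
  then obtain c where c: "c ` {..degree P q} \<subseteq> P" "strict_mono_on {..degree P q} c"
      "c (degree P q) = q"
    by (auto simp: chain_lengths_def)
  define c' where "c' = c(Suc (degree P q) := p)"
  have le: "c i \<le> q" if "i \<le> degree P q" for i
    using strict_mono_onD[OF c(2), of i "degree P q"] that c(3)
    by (cases "i = degree P q") auto
  have "strict_mono_on {..Suc (degree P q)} c'"
  proof (rule strict_mono_onI)
    fix i j
    assume ij: "i \<in> {..Suc (degree P q)}" "j \<in> {..Suc (degree P q)}" "i < j"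
    show "c' i < c' j"
    proof (cases "j = Suc (degree P q)")
      case True
      then show ?thesis using ij le[of i] assms(4) by (auto simp: c'_def)
    next
      case False
      then show ?thesis using ij strict_mono_onD[OF c(2), of i j] by (auto simp: c'_def)
    qed
  qed
  moreover have "c' ` {..Suc (degree P q)} \<subseteq> P"
    using c(1) assms(3) by (auto simp: c'_def image_subset_iff le_Suc_eq)
  moreover have "c' (Suc (degree P q)) = p"
    by (simp add: c'_def)
  ultimately have "Suc (degree P q) \<in> chain_lengths P p"
    unfolding chain_lengths_def by blast
  then have "Suc (degree P q) \<le> degree P p"
    unfolding degree_def[of P p] by (rule Max_ge[OF chain_lengths_finite[OF assms(1)]])
  then show ?thesis by simp
qed

lemma labelling_filtered:
  assumes "filtered P" "p \<in> P"
  shows "degree P p = 0 \<Longrightarrow> labelling P p = 0"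
    and "degree P p = 1 \<Longrightarrow> labelling P p = 1"
    and "\<lbrakk>degree P p \<ge> 2; m = Max (labelling P ` {q \<in> P. q < p});
          S = {s \<in> P. s < p \<and> m - 1 \<le> labelling P s \<and> labelling P s \<le> m}\<rbrakk>
         \<Longrightarrow> labelling P p = (if closes_circuit p S then m + 1 else m)"
proof -
  have Q: "{q \<in> P. q < p \<and> degree P q < degree P p} = {q \<in> P. q < p}"
    using degree_less[OF assms(1) _ assms(2)] by auto
  show "labelling P p = 0" if "degree P p = 0"
    using that by (simp add: labelling.simps)
  show "labelling P p = 1" if "degree P p = 1"
    using that by (simp add: labelling.simps)
  show "labelling P p = (if closes_circuit p S then m + 1 else m)"
    if deg: "degree P p \<ge> 2" and m: "m = Max (labelling P ` {q \<in> P. q < p})"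
      and S: "S = {s \<in> P. s < p \<and> m - 1 \<le> labelling P s \<and> labelling P s \<le> m}"
  proof -
    let ?L = "(\<lambda>q. (q, labelling P q)) ` {q \<in> P. q < p}"
    have m': "Max (snd ` ?L) = m"
      by (simp add: m image_image)
    have S': "fst ` {(s, b) \<in> ?L. m - 1 \<le> b \<and> b \<le> m} = S"
      unfolding S by force
    show ?thesis
      using deg by (subst labelling.simps) (simp only: Let_def Q m' S', simp)
  qed
qed

section \<open>Modules\<close>

definition mod_hom ::
  "('r, 'x) ring_scheme \<Rightarrow> ('r, 'm) module \<Rightarrow> ('r, 'n) module \<Rightarrow> ('m \<Rightarrow> 'n) set" where
  "mod_hom R M N = {f \<in> hom (add_monoid M) (add_monoid N).
     \<forall>a \<in> carrier R. \<forall>x \<in> carrier M. f (a \<odot>\<^bsub>M\<^esub> x) = a \<odot>\<^bsub>N\<^esub> f x}"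

text \<open>
  The fields \<open>mult\<close> and \<open>one\<close> of a \<open>module\<close> record are not part of the module structure.
\<close>

definition quotient_module :: "('r, 'm) module \<Rightarrow> 'm set \<Rightarrow> ('r, 'm set) module" where
  "quotient_module M N =
     \<lparr>carrier = a_rcosets\<^bsub>M\<^esub> N, mult = undefined, one = undefined,
      zero = N, add = set_add M,
      smult = (\<lambda>a X. \<Union>x\<in>X. N +>\<^bsub>M\<^esub> (a \<odot>\<^bsub>M\<^esub> x))\<rparr>"

text \<open>
  Cohomology of a cochain complex of modules concentrated in degrees \<open>\<ge> 0\<close>, so that the incoming
  differential in degree \<open>0\<close> is zero.
\<close>

definition coboundaries ::
  "(nat \<Rightarrow> ('r, 'm) module) \<Rightarrow> (nat \<Rightarrow> 'm \<Rightarrow> 'm) \<Rightarrow> nat \<Rightarrow> 'm set" where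
  "coboundaries M d k =
     (case k of 0 \<Rightarrow> {\<zero>\<^bsub>M 0\<^esub>} | Suc j \<Rightarrow> d j ` carrier (M j))"

definition cohomology ::
  "(nat \<Rightarrow> ('r, 'm) module) \<Rightarrow> (nat \<Rightarrow> 'm \<Rightarrow> 'm) \<Rightarrow> nat \<Rightarrow> ('r, 'm set) module" where
  "cohomology M d k =
     quotient_module ((M k)\<lparr>carrier := a_kernel (M k) (M (Suc k)) (d k)\<rparr>) (coboundaries M d k)"

section \<open>The category of contravariant functors to modules\<close>

text \<open>
  A functor on \<open>P\<^sup>o\<^sup>p\<close>: for \<open>p \<le> q\<close>, the value on the arrow \<open>p \<rightarrow> q\<close> is \<open>res F p q\<close>, which maps
  \<open>obj F q\<close> to \<open>obj F p\<close>. Homomorphisms only matter on carriers.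
\<close>

record ('p, 'r, 'm) presheaf =
  obj :: "'p \<Rightarrow> ('r, 'm) module"
  res :: "'p \<Rightarrow> 'p \<Rightarrow> 'm \<Rightarrow> 'm"

definition is_presheaf ::
  "('r, 'x) ring_scheme \<Rightarrow> 'p::order set \<Rightarrow> ('p, 'r, 'm) presheaf \<Rightarrow> bool" where
  "is_presheaf R P F \<longleftrightarrow>
     (\<forall>p\<in>P. Module.module R (obj F p)) \<and>
     (\<forall>p\<in>P. \<forall>q\<in>P. p \<le> q \<longrightarrow> res F p q \<in> mod_hom R (obj F q) (obj F p)) \<and>
     (\<forall>p\<in>P. \<forall>x \<in> carrier (obj F p). res F p p x = x) \<and>
     (\<forall>p\<in>P. \<forall>q\<in>P. \<forall>r\<in>P. p \<le> q \<longrightarrow> q \<le> r \<longrightarrow>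
        (\<forall>x \<in> carrier (obj F r). res F p q (res F q r x) = res F p r x))"

definition nat_trans ::
  "('r, 'x) ring_scheme \<Rightarrow> 'p::order set \<Rightarrow> ('p, 'r, 'm) presheaf \<Rightarrow> ('p, 'r, 'n) presheaf
     \<Rightarrow> ('p \<Rightarrow> 'm \<Rightarrow> 'n) set" where
  "nat_trans R P F G =
     {\<eta>. (\<forall>p\<in>P. \<eta> p \<in> mod_hom R (obj F p) (obj G p)) \<and>
         (\<forall>p\<in>P. \<forall>q\<in>P. p \<le> q \<longrightarrow>
            (\<forall>x \<in> carrier (obj F q). \<eta> p (res F p q x) = res G p q (\<eta> q x)))}"

text \<open>
  Monomorphisms, kernels and images in the functor category are computed objectwise.
\<close>

definition monic ::
  "'p::order set \<Rightarrow> ('p, 'r, 'm) presheaf \<Rightarrow> ('p \<Rightarrow> 'm \<Rightarrow> 'n) \<Rightarrow> bool" where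
  "monic P F \<eta> \<longleftrightarrow> (\<forall>p\<in>P. inj_on (\<eta> p) (carrier (obj F p)))"

text \<open>
  Injective objects of the category of functors whose values are modules with elements in the
  fixed type \<open>'u\<close>.
\<close>

definition injective_presheaf ::
  "('r, 'x) ring_scheme \<Rightarrow> 'p::order set \<Rightarrow> ('p, 'r, 'u) presheaf \<Rightarrow> bool" where
  "injective_presheaf R P I \<longleftrightarrow>
     is_presheaf R P I \<and>
     (\<forall>(A :: ('p, 'r, 'u) presheaf) (B :: ('p, 'r, 'u) presheaf) i f.
        is_presheaf R P A \<and> is_presheaf R P B \<and>
        i \<in> nat_trans R P A B \<and> monic P A i \<and> f \<in> nat_trans R P A I \<longrightarrow>
        (\<exists>g \<in> nat_trans R P B I. \<forall>p\<in>P. \<forall>x \<in> carrier (obj A p). g p (i p x) = f p x))"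

text \<open>
  \<open>0 \<rightarrow> F \<rightarrow> I 0 \<rightarrow> I 1 \<rightarrow> \<dots>\<close> is exact, with augmentation \<open>\<epsilon>\<close>, differentials \<open>\<delta>\<close> and injective \<open>I n\<close>.
\<close>

definition injective_resolution ::
  "('r, 'x) ring_scheme \<Rightarrow> 'p::order set \<Rightarrow> ('p, 'r, 'm) presheaf
     \<Rightarrow> (nat \<Rightarrow> ('p, 'r, 'u) presheaf) \<Rightarrow> ('p \<Rightarrow> 'm \<Rightarrow> 'u) \<Rightarrow> (nat \<Rightarrow> 'p \<Rightarrow> 'u \<Rightarrow> 'u) \<Rightarrow> bool" where
  "injective_resolution R P F I \<epsilon> \<delta> \<longleftrightarrow>
     (\<forall>n. injective_presheaf R P (I n)) \<and>
     \<epsilon> \<in> nat_trans R P F (I 0) \<and>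
     (\<forall>n. \<delta> n \<in> nat_trans R P (I n) (I (Suc n))) \<and>
     monic P F \<epsilon> \<and>
     (\<forall>p\<in>P. \<epsilon> p ` carrier (obj F p) = a_kernel (obj (I 0) p) (obj (I 1) p) (\<delta> 0 p)) \<and>
     (\<forall>n. \<forall>p\<in>P. \<delta> n p ` carrier (obj (I n) p) =
        a_kernel (obj (I (Suc n)) p) (obj (I (Suc (Suc n))) p) (\<delta> (Suc n) p))"

text \<open>
  A universe for resolutions. Functors with values in modules over a type \<open>'m\<close> embed into functors
  with values in modules over \<open>('p, 'r, 'm) univ\<close>. The cardinality \<open>\<lambda>\<close> of the latter type satisfies
  \<open>\<lambda>^\<kappa> = \<lambda>\<close> for \<open>\<kappa>\<close> the cardinality of \<open>'p \<times> 'r \<times> nat\<close>. Hence it has room for injective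
  envelopes of modules over rings in \<open>'r\<close>, for products of modules indexed by subsets of \<open>'p\<close>, and
  for quotients of modules, so that there are enough injectives and injective resolutions exist.
  It also has room for all ideals of the ring, hence for all subfunctors of the representable
  functors; by Baer's criterion an injective object over this universe is therefore
  injective with respect to functors with values in arbitrary modules.
\<close>

type_synonym ('p, 'r, 'm) univ = "'p \<times> 'r \<times> nat \<Rightarrow> 'm set"

section \<open>Limits and their derived functors\<close>

definition lim_module :: "'p::order set \<Rightarrow> ('p, 'r, 'm) presheaf \<Rightarrow> ('r, 'p \<Rightarrow> 'm) module" where
  "lim_module P F =
     \<lparr>carrier = {x \<in> (\<Pi>\<^sub>E p\<in>P. carrier (obj F p)).
                   \<forall>p\<in>P. \<forall>q\<in>P. p \<le> q \<longrightarrow> res F p q (x q) = x p},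
      mult = undefined, one = undefined,
      zero = (\<lambda>p\<in>P. \<zero>\<^bsub>obj F p\<^esub>),
      add = (\<lambda>x y. \<lambda>p\<in>P. x p \<oplus>\<^bsub>obj F p\<^esub> y p),
      smult = (\<lambda>a x. \<lambda>p\<in>P. a \<odot>\<^bsub>obj F p\<^esub> x p)\<rparr>"

definition lim_map :: "'p set \<Rightarrow> ('p \<Rightarrow> 'm \<Rightarrow> 'n) \<Rightarrow> ('p \<Rightarrow> 'm) \<Rightarrow> 'p \<Rightarrow> 'n" where
  "lim_map P \<eta> x = (\<lambda>p\<in>P. \<eta> p (x p))"

text \<open>
  The \<open>k\<close>-th right derived functor of the limit, computed from the injective resolution
  \<open>(I, \<delta>)\<close>; up to isomorphism it depends only on the resolved functor.
\<close>

definition derived_lim ::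
  "'p::order set \<Rightarrow> (nat \<Rightarrow> ('p, 'r, 'u) presheaf) \<Rightarrow> (nat \<Rightarrow> 'p \<Rightarrow> 'u \<Rightarrow> 'u) \<Rightarrow> nat
     \<Rightarrow> ('r, ('p \<Rightarrow> 'u) set) module" where
  "derived_lim P I \<delta> k = cohomology (\<lambda>n. lim_module P (I n)) (\<lambda>n. lim_map P (\<delta> n)) k"

end

theory Submission
  imports Defs
begin

text \<open>
  The cohomology of a lower set \<open>D\<close> is computed by the sections over \<open>D\<close> of an injective resolution.
  A cone (the set of elements below some \<open>p\<close>, including \<open>p\<close>) has no cohomology in positive degrees,
  since its limit is the value at \<open>p\<close>. Hence a cocycle of degree \<open>k + 1\<close> can be integrated over \<open>p\<close>
  after it has been integrated strictly below \<open>p\<close>, provided the cohomology of degree \<open>k\<close> of the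
  elements strictly below \<open>p\<close> vanishes (\<open>cone_extension\<close>). By well-founded recursion, the
  cohomology of \<open>P\<close> vanishes in degree \<open>k + 1\<close> as soon as this local condition holds at every \<open>p\<close>
  (\<open>acyclic_in_Suc\<close>).

  The labelling is made so that the local condition holds for all \<open>k \<ge> B(p)\<close> (\<open>acyclic_in_below\<close>),
  by induction on the degree of \<open>p\<close>. If \<open>B(p)\<close> exceeds all labels below \<open>p\<close>, this is the previous
  argument applied to the elements below \<open>p\<close>. Otherwise \<open>B(p)\<close> is the maximal label \<open>m\<close> below \<open>p\<close>,
  and no circuit closes: the elements with labels \<open>m - 1\<close> and \<open>m\<close> form a disjoint union of cones
  (\<open>no_circuit_apex\<close>). The elements with smaller labels form a lower set \<open>L\<close> without cohomology
  in degrees from \<open>m - 1\<close> on, and the same is true of the intersection of \<open>L\<close> with each cone. A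
  Mayer--Vietoris argument for the cover by \<open>L\<close> and these cones (\<open>acyclic_in_union_cones\<close>) then
  gives the missing vanishing in degree \<open>m\<close>.

  The only consequence of injectivity that enters is that sections over a lower set below \<open>t\<close> extend
  to \<open>t\<close> (\<open>injective_presheaf_flasque\<close>).
\<close>

section \<open>Degrees and labels\<close>

lemma degree_in_chain_lengths:
  assumes "filtered P" "p \<in> P"
  shows "degree P p \<in> chain_lengths P p"
proof -
  have "0 \<in> chain_lengths P p"
    using assms(2) by (auto simp: chain_lengths_def monotone_on_def intro!: exI[of _ "\<lambda>_. p"])
  then show ?thesis
    using Max_in[OF chain_lengths_finite[OF assms(1)]] unfolding degree_def by blast
qed

lemma degree_predecessor:
  assumes "filtered P" "p \<in> P" "degree P p = Suc n"
  obtains q where "q \<in> P" "q < p" "n \<le> degree P q"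
proof -
  obtain c where c: "c ` {..Suc n} \<subseteq> P" "strict_mono_on {..Suc n} c" "c (Suc n) = p"
    using degree_in_chain_lengths[OF assms(1,2)] assms(3) by (auto simp: chain_lengths_def)
  have "strict_mono_on {..n} c"
    using c(2) by (rule monotone_on_subset) auto
  moreover have "c ` {..n} \<subseteq> P"
    using c(1) by auto
  ultimately have "n \<in> chain_lengths P (c n)"
    unfolding chain_lengths_def by blast
  then have "n \<le> degree P (c n)"
    unfolding degree_def by (rule Max_ge[OF chain_lengths_finite[OF assms(1)]])
  moreover have "c n \<in> P" "c n < p"
    using c(1) strict_mono_onD[OF c(2), of n "Suc n"] c(3) by auto
  ultimately show ?thesis using that by blast
qed

lemma labelling_le_degree:
  assumes "filtered P" "p \<in> P"
  shows "labelling P p \<le> degree P p"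
  using assms(2)
proof (induction "degree P p" arbitrary: p rule: less_induct)
  case less
  consider "degree P p = 0" | "degree P p = 1" | n where "degree P p = Suc (Suc n)"
    by (metis One_nat_def not0_implies_Suc)
  then show ?case
  proof cases
    case (3 n)
    let ?A = "labelling P ` {q \<in> P. q < p}"
    obtain q where "q \<in> P" "q < p"
      using degree_predecessor[OF assms(1) less.prems 3] by blast
    moreover have le: "\<forall>b\<in>?A. b \<le> Suc n"
      using less degree_less[OF assms(1) _ less.prems] 3 by fastforce
    ultimately have "Max ?A \<le> Suc n"
      by (subst Max_le_iff) (auto intro: finite_subset[of _ "{..Suc n}"])
    then show ?thesis
      using labelling_filtered(3)[OF assms(1) less.prems _ refl refl] 3 by simp
  qed (use labelling_filtered[OF assms(1) less.prems] in simp_all)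
qed

text \<open>
  The two ways in which a label arises. In the first case the label is strictly above everything
  below \<open>p\<close>; this covers degrees \<open>0\<close> and \<open>1\<close> as well as the elements that close a circuit. In the
  second case the label is the maximum found below \<open>p\<close>, and the set \<open>\<B>\<^sub>p\<close> of the definition can be
  written in terms of \<open>labelling P p\<close> itself, since labels below \<open>p\<close> cannot exceed it.
\<close>
lemma labelling_cases:
  assumes "filtered P" "p \<in> P"
  obtains
    (new) "\<And>q. q \<in> P \<Longrightarrow> q < p \<Longrightarrow> labelling P q < labelling P p"
  | (inherited) "degree P p \<ge> 2" "\<And>q. q \<in> P \<Longrightarrow> q < p \<Longrightarrow> labelling P q \<le> labelling P p"
      "\<not> closes_circuit p {s \<in> P. s < p \<and> labelling P p \<le> Suc (labelling P s)}"
proof -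
  note deg = degree_less[OF assms(1) _ assms(2)]
  consider "degree P p = 0" | "degree P p = 1" | n where "degree P p = Suc (Suc n)"
    by (metis One_nat_def not0_implies_Suc)
  then show ?thesis
  proof cases
    case 1
    then show ?thesis using deg new by fastforce
  next
    case 2
    then have "labelling P q = 0" if "q \<in> P" "q < p" for q
      using deg[OF that] labelling_le_degree[OF assms(1) that(1)] by simp
    then show ?thesis
      using labelling_filtered(2)[OF assms] 2 new by simp
  next
    case (3 n)
    let ?A = "labelling P ` {q \<in> P. q < p}"
    have "?A \<subseteq> {..degree P p}"
      using deg labelling_le_degree[OF assms(1)] by fastforce
    then have fin: "finite ?A" by (rule finite_subset) simp
    have le: "labelling P q \<le> Max ?A" if "q \<in> P" "q < p" for q
      using that by (intro Max_ge fin) auto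
    define S where "S = {s \<in> P. s < p \<and> Max ?A - 1 \<le> labelling P s \<and> labelling P s \<le> Max ?A}"
    have B: "labelling P p = (if closes_circuit p S then Max ?A + 1 else Max ?A)"
      using 3 by (intro labelling_filtered(3)[OF assms _ refl]) (simp_all add: S_def)
    show ?thesis
    proof (cases "closes_circuit p S")
      case True
      then show ?thesis using B le new by fastforce
    next
      case False
      then have m: "labelling P p = Max ?A" using B by simp
      have "S = {s \<in> P. s < p \<and> labelling P p \<le> Suc (labelling P s)}"
        using le by (auto simp: S_def m)
      then show ?thesis
        using False 3 le m by (intro inherited) simp_all
    qed
  qed
qed

lemma labelling_mono:
  assumes "filtered P" "q \<in> P" "p \<in> P" "q < p"
  shows "labelling P q \<le> labelling P p"
  using labelling_cases[OF assms(1,3)] assms(2,4) by (metis less_imp_le)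

lemma labelling_pos:
  assumes "filtered P" "p \<in> P" "degree P p > 0"
  shows "labelling P p > 0"
  using assms(2,3)
proof (induction "degree P p" arbitrary: p rule: less_induct)
  case less
  obtain n where n: "degree P p = Suc n"
    using less.prems(2) gr0_implies_Suc by blast
  obtain q where q: "q \<in> P" "q < p" "n \<le> degree P q"
    using degree_predecessor[OF assms(1) less.prems(1) n] by blast
  show ?case
  proof (cases n)
    case 0
    then show ?thesis using n labelling_filtered(2)[OF assms(1) less.prems(1)] by simp
  next
    case (Suc n')
    then have "labelling P q > 0"
      using q degree_less[OF assms(1) q(1) less.prems(1) q(2)] by (intro less.hyps) auto
    then show ?thesis
      using labelling_mono[OF assms(1) q(1) less.prems(1) q(2)] by simp
  qed
qed

text \<open>
  Degrees below \<open>p\<close> are bounded, so every element of \<open>S\<close> lies under a maximal one. For \<open>q \<le> q'\<close>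
  the maximal elements above \<open>q\<close> and \<open>q'\<close> are in the same component, hence equal if no circuit
  closes. So \<open>S\<close> is a disjoint union of mutually incomparable cones, and \<open>apex\<close> sends each element to
  the tip of its cone.
\<close>
lemma no_circuit_apex:
  assumes "filtered P" "p \<in> P" "S \<subseteq> {q \<in> P. q < p}" "\<not> closes_circuit p S"
  shows "\<exists>apex. (\<forall>q\<in>S. apex q \<in> S \<and> q \<le> apex q) \<and>
    (\<forall>q\<in>S. \<forall>q'\<in>S. q \<le> q' \<longrightarrow> apex q = apex q')"
proof -
  have "\<exists>t\<in>S. q \<le> t \<and> (\<forall>u\<in>S. \<not> t < u)" if "q \<in> S" for q
    using that
  proof (induction "degree P p - degree P q" arbitrary: q rule: less_induct)
    case less
    show ?case
    proof (cases "\<exists>u\<in>S. q < u")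
      case True
      then obtain u where u: "u \<in> S" "q < u" by blast
      have "degree P q < degree P u" "degree P u < degree P p"
        using u less.prems assms(3) by (auto intro!: degree_less[OF assms(1)] assms(2))
      then have "\<exists>t\<in>S. u \<le> t \<and> (\<forall>v\<in>S. \<not> t < v)"
        using less.hyps[of u] u(1) by simp
      then show ?thesis using u(2) by (meson less_imp_le order.trans)
    qed (use less.prems in blast)
  qed
  then obtain apex where apex: "\<And>q. q \<in> S \<Longrightarrow> apex q \<in> S" "\<And>q. q \<in> S \<Longrightarrow> q \<le> apex q"
    "\<And>q u. q \<in> S \<Longrightarrow> u \<in> S \<Longrightarrow> \<not> apex q < u"
    by metis
  \<comment> \<open>The relation whose transitive closure has the components as its classes.\<close>
  let ?E = "{(x, y). x \<in> S \<and> y \<in> S \<and> (x \<le> y \<or> y \<le> x)}"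
  have "apex q = apex q'" if q: "q \<in> S" "q' \<in> S" "q \<le> q'" for q q'
  proof (rule ccontr)
    assume neq: "apex q \<noteq> apex q'"
    let ?C = "?E\<^sup>+ `` {q}"
    have "(q, apex q) \<in> ?E" "(q, q') \<in> ?E" "(q', apex q') \<in> ?E"
      using q apex(1,2) by auto
    then have in_C: "apex q \<in> ?C" "apex q' \<in> ?C"
      by (auto intro: trancl.intros)
    have "?C \<subseteq> S"
      using trancl_range[of ?E] by (force elim: tranclE)
    then have "apex q \<in> maximal_elements ?C" "apex q' \<in> maximal_elements ?C"
      using in_C apex(3) q by (auto simp: maximal_elements_def)
    moreover have "?C \<in> poset_components S"
      unfolding poset_components_def using q(1) by (rule quotientI)
    ultimately show False
      using assms(3,4) neq unfolding closes_circuit_def by blast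
  qed
  then show ?thesis using apex(1,2) by (intro exI[of _ apex]) blast
qed

section \<open>Sections over lower sets\<close>

definition lower_in :: "'p::order set \<Rightarrow> 'p set \<Rightarrow> bool" where
  "lower_in P D \<longleftrightarrow> D \<subseteq> P \<and> (\<forall>p\<in>D. \<forall>q\<in>P. q \<le> p \<longrightarrow> q \<in> D)"

definition sections_on :: "('p::order, 'r, 'm) presheaf \<Rightarrow> 'p set \<Rightarrow> ('p \<Rightarrow> 'm) set" where
  "sections_on G D =
     {s. (\<forall>p\<in>D. s p \<in> carrier (obj G p)) \<and>
         (\<forall>p\<in>D. \<forall>q\<in>D. p \<le> q \<longrightarrow> res G p q (s q) = s p)}"

lemma mod_hom_abelian_group_hom:
  assumes "f \<in> mod_hom R M N" "Module.module R M" "Module.module R N"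
  shows "abelian_group_hom M N f"
proof -
  interpret M: Module.module R M by fact
  interpret N: Module.module R N by fact
  show ?thesis
    by (rule abelian_group_homI)
      (use assms(1) M.abelian_group_axioms N.abelian_group_axioms in
        \<open>auto simp: mod_hom_def group_hom_def group_hom_axioms_def
          intro: M.a_group N.a_group\<close>)
qed

text \<open>
  The constant functor with value \<open>R\<close> on a lower set and \<open>0\<close> elsewhere, with elements renamed along
  \<open>e\<close> so that they live in the type over which injectivity is available. If the lower set consists
  of all elements below \<open>t\<close>, it is the free functor on one generator in \<open>t\<close>, that is, the
  linearization of the representable functor of \<open>t\<close>.
\<close>
definition lower_presheaf ::
  "('r, 'x) ring_scheme \<Rightarrow> ('r \<Rightarrow> 'u) \<Rightarrow> 'p set \<Rightarrow> ('p, 'r, 'u) presheaf" where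
  "lower_presheaf R e D =
     \<lparr>obj = \<lambda>p. \<lparr>carrier = e ` (if p \<in> D then carrier R else {\<zero>\<^bsub>R\<^esub>}),
                mult = undefined, one = undefined, zero = e \<zero>\<^bsub>R\<^esub>,
                add = \<lambda>x y. e (the_inv_into (carrier R) e x \<oplus>\<^bsub>R\<^esub> the_inv_into (carrier R) e y),
                smult = \<lambda>a x. e (a \<otimes>\<^bsub>R\<^esub> the_inv_into (carrier R) e x)\<rparr>,
      res = \<lambda>_ _ x. x\<rparr>"

lemma is_presheaf_lower_presheaf:
  assumes "cring R" "inj_on e (carrier R)" "lower_in P D"
  shows "is_presheaf R P (lower_presheaf R e D)"
proof -
  interpret cring R by fact
  note inv = the_inv_into_f_f[OF assms(2)]
  have mod: "Module.module R (obj (lower_presheaf R e D) p)" for p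
  proof (rule moduleI)
    show "abelian_group (obj (lower_presheaf R e D) p)"
    proof (rule abelian_groupI)
      fix x assume "x \<in> carrier (obj (lower_presheaf R e D) p)"
      then obtain a where a: "x = e a" "a \<in> (if p \<in> D then carrier R else {\<zero>\<^bsub>R\<^esub>})"
        by (auto simp: lower_presheaf_def)
      then show "\<exists>y\<in>carrier (obj (lower_presheaf R e D) p).
          y \<oplus>\<^bsub>obj (lower_presheaf R e D) p\<^esub> x = \<zero>\<^bsub>obj (lower_presheaf R e D) p\<^esub>"
        by (intro bexI[of _ "e (\<ominus>\<^bsub>R\<^esub> a)"]) (auto simp: lower_presheaf_def inv l_neg split: if_splits)
    qed (auto simp: lower_presheaf_def inv a_ac split: if_splits)
  qed (auto simp: lower_presheaf_def inv l_distr r_distr m_assoc assms(1) split: if_splits)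
  show ?thesis
    using assms(3) mod unfolding is_presheaf_def
    by (auto simp: mod_hom_def hom_def lower_presheaf_def lower_in_def inv split: if_splits)
qed

text \<open>
  A section over \<open>D\<close> is the same as a morphism from the subfunctor of the free functor on \<open>t\<close> that
  is supported on \<open>D\<close>, mapping \<open>1\<close> at \<open>q\<close> to \<open>s q\<close>. Injectivity extends it to the whole free functor,
  and the image of the generator at \<open>t\<close> is the required element.
\<close>
lemma injective_presheaf_flasque:
  fixes R :: "('r, 'x) ring_scheme" and P :: "'p::order set"
    and G :: "('p, 'r, 'u) presheaf" and e :: "'r \<Rightarrow> 'u"
  assumes "cring R" "inj_on e (carrier R)" "injective_presheaf R P G"
    and "t \<in> P" "lower_in P D" "D \<subseteq> {..t}" "s \<in> sections_on G D"
  shows "\<exists>x \<in> carrier (obj G t). \<forall>q\<in>D. res G q t x = s q"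
proof -
  interpret cring R by fact
  note inv = the_inv_into_f_f[OF assms(2)]
  have G: "is_presheaf R P G"
    using assms(3) by (simp add: injective_presheaf_def)
  have DP: "D \<subseteq> P" using assms(5) by (simp add: lower_in_def)
  let ?T = "{q \<in> P. q \<le> t}"
  let ?A = "lower_presheaf R e D" and ?B = "lower_presheaf R e ?T"
  let ?f = "\<lambda>q x. if q \<in> D then the_inv_into (carrier R) e x \<odot>\<^bsub>obj G q\<^esub> s q else \<zero>\<^bsub>obj G q\<^esub>"
  have T: "lower_in P ?T" by (auto simp: lower_in_def)
  have i: "(\<lambda>_ x. x) \<in> nat_trans R P ?A ?B"
    using assms(5,6) by (auto simp: nat_trans_def mod_hom_def hom_def lower_presheaf_def lower_in_def)
  have mono: "monic P ?A (\<lambda>_ x. x)" by (simp add: monic_def)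
  have f: "?f \<in> nat_trans R P ?A G"
  proof -
    have "?f p \<in> mod_hom R (obj ?A p) (obj G p)" if p: "p \<in> P" for p
    proof -
      interpret M: Module.module R "obj G p"
        using G p by (simp add: is_presheaf_def)
      show ?thesis
        using assms(7) by (auto simp: mod_hom_def hom_def lower_presheaf_def sections_on_def inv
            M.smult_l_distr M.smult_assoc1)
    qed
    moreover have "?f p (res ?A p q x) = res G p q (?f q x)"
      if "p \<in> P" "q \<in> P" "p \<le> q" "x \<in> carrier (obj ?A q)" for p q x
    proof -
      interpret M: Module.module R "obj G p"
        using G that by (simp add: is_presheaf_def)
      interpret N: Module.module R "obj G q"
        using G that by (simp add: is_presheaf_def)
      have h: "res G p q \<in> mod_hom R (obj G q) (obj G p)"
        using G that by (simp add: is_presheaf_def)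
      interpret h: abelian_group_hom "obj G q" "obj G p" "res G p q"
        by (rule mod_hom_abelian_group_hom[OF h N.module_axioms M.module_axioms])
      show ?thesis
      proof (cases "q \<in> D")
        case True
        then have "p \<in> D" using assms(5) that by (auto simp: lower_in_def)
        then show ?thesis
          using True that(3,4) assms(7) h
          by (auto simp: lower_presheaf_def inv sections_on_def mod_hom_def)
      next
        case False
        then show ?thesis
          using that assms(7) by (auto simp: lower_presheaf_def inv sections_on_def h.hom_zero)
      qed
    qed
    ultimately show ?thesis by (simp add: nat_trans_def)
  qed
  have "\<exists>g \<in> nat_trans R P ?B G. \<forall>p\<in>P. \<forall>x \<in> carrier (obj ?A p). g p x = ?f p x"
    using assms(3)[unfolded injective_presheaf_def, THEN conjunct2, rule_format,
        of ?A ?B "\<lambda>_ x. x" ?f]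
      is_presheaf_lower_presheaf[OF assms(1,2,5)] is_presheaf_lower_presheaf[OF assms(1,2) T]
      i mono f by simp
  then obtain g where g: "g \<in> nat_trans R P ?B G"
    "\<forall>p\<in>P. \<forall>x \<in> carrier (obj ?A p). g p x = ?f p x"
    by (elim bexE)
  let ?x = "e \<one>\<^bsub>R\<^esub>"
  have "g t \<in> mod_hom R (obj ?B t) (obj G t)"
    using g(1) assms(4) by (simp add: nat_trans_def)
  moreover have B: "?x \<in> carrier (obj ?B t)"
    using assms(4) by (simp add: lower_presheaf_def)
  ultimately have "g t ?x \<in> carrier (obj G t)"
    unfolding mod_hom_def hom_def by auto
  moreover have "res G q t (g t ?x) = s q" if q: "q \<in> D" for q
  proof -
    interpret M: Module.module R "obj G q"
      using G q DP by (auto simp: is_presheaf_def)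
    have "g q (res ?B q t ?x) = res G q t (g t ?x)"
      using g(1) q assms(4,6) DP B unfolding nat_trans_def by blast
    then have "res G q t (g t ?x) = g q ?x"
      by (simp add: lower_presheaf_def)
    also have "\<dots> = s q"
      using g(2)[rule_format, of q ?x] q DP assms(7) by (auto simp: lower_presheaf_def inv sections_on_def)
    finally show ?thesis .
  qed
  ultimately show ?thesis by blast
qed

section \<open>Acyclic lower sets\<close>

text \<open>
  The part of an injective resolution that computes cohomology: exactness in positive degrees, and
  the extension of sections to tips of cones in place of injectivity. The predicate \<open>acyclic_in k D\<close>
  below says that the cohomology of the lower set \<open>D\<close> vanishes in degree \<open>k\<close>.
\<close>
locale flasque_resolution =
  fixes R :: "('r, 'x) ring_scheme" and P :: "'p::order set"
    and I :: "nat \<Rightarrow> ('p, 'r, 'u) presheaf" and \<delta> :: "nat \<Rightarrow> 'p \<Rightarrow> 'u \<Rightarrow> 'u"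
  assumes filtered: "filtered P"
    and presheaf: "is_presheaf R P (I n)"
    and differential: "\<delta> n \<in> nat_trans R P (I n) (I (Suc n))"
    and exact: "p \<in> P \<Longrightarrow> \<delta> n p ` carrier (obj (I n) p) =
      a_kernel (obj (I (Suc n)) p) (obj (I (Suc (Suc n))) p) (\<delta> (Suc n) p)"
    and flasque: "t \<in> P \<Longrightarrow> lower_in P D \<Longrightarrow> D \<subseteq> {..t} \<Longrightarrow> s \<in> sections_on (I n) D \<Longrightarrow>
      \<exists>x \<in> carrier (obj (I n) t). \<forall>q\<in>D. res (I n) q t x = s q"
begin

abbreviation below :: "'p \<Rightarrow> 'p set" where
  "below p \<equiv> {q \<in> P. q < p}"

definition cocycle :: "nat \<Rightarrow> 'p set \<Rightarrow> ('p \<Rightarrow> 'u) \<Rightarrow> bool" where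
  "cocycle k D x \<longleftrightarrow>
     x \<in> sections_on (I k) D \<and> (\<forall>p\<in>D. \<delta> k p (x p) = \<zero>\<^bsub>obj (I (Suc k)) p\<^esub>)"

definition coboundary :: "nat \<Rightarrow> 'p set \<Rightarrow> ('p \<Rightarrow> 'u) \<Rightarrow> bool" where
  "coboundary k D x \<longleftrightarrow>
     (case k of 0 \<Rightarrow> \<forall>p\<in>D. x p = \<zero>\<^bsub>obj (I 0) p\<^esub>
      | Suc j \<Rightarrow> \<exists>y \<in> sections_on (I j) D. \<forall>p\<in>D. \<delta> j p (y p) = x p)"

definition acyclic_in :: "nat \<Rightarrow> 'p set \<Rightarrow> bool" where
  "acyclic_in k D \<longleftrightarrow> (\<forall>x. cocycle k D x \<longrightarrow> coboundary k D x)"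

lemma module_obj: "p \<in> P \<Longrightarrow> Module.module R (obj (I n) p)"
  using presheaf by (simp add: is_presheaf_def)

lemma abelian_group_obj: "p \<in> P \<Longrightarrow> abelian_group (obj (I n) p)"
  using module_obj Module.module.axioms(2) by blast

lemma hom_res:
  "p \<in> P \<Longrightarrow> q \<in> P \<Longrightarrow> p \<le> q \<Longrightarrow> abelian_group_hom (obj (I n) q) (obj (I n) p) (res (I n) p q)"
  using presheaf[of n] by (intro mod_hom_abelian_group_hom[of _ R]) (auto simp: is_presheaf_def)

lemma hom_differential:
  "p \<in> P \<Longrightarrow> abelian_group_hom (obj (I n) p) (obj (I (Suc n)) p) (\<delta> n p)"
  using differential[of n]
  by (intro mod_hom_abelian_group_hom[of _ R] module_obj) (auto simp: nat_trans_def)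

lemma res_comp:
  "p \<in> P \<Longrightarrow> q \<in> P \<Longrightarrow> r \<in> P \<Longrightarrow> p \<le> q \<Longrightarrow> q \<le> r \<Longrightarrow> x \<in> carrier (obj (I n) r) \<Longrightarrow>
   res (I n) p q (res (I n) q r x) = res (I n) p r x"
  using presheaf[of n] by (auto simp: is_presheaf_def)

lemma res_refl: "p \<in> P \<Longrightarrow> x \<in> carrier (obj (I n) p) \<Longrightarrow> res (I n) p p x = x"
  using presheaf[of n] by (auto simp: is_presheaf_def)

lemma differential_res:
  "p \<in> P \<Longrightarrow> q \<in> P \<Longrightarrow> p \<le> q \<Longrightarrow> x \<in> carrier (obj (I n) q) \<Longrightarrow>
   \<delta> n p (res (I n) p q x) = res (I (Suc n)) p q (\<delta> n q x)"
  using differential[of n] by (auto simp: nat_trans_def)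

lemma res_closed:
  "p \<in> P \<Longrightarrow> q \<in> P \<Longrightarrow> p \<le> q \<Longrightarrow> x \<in> carrier (obj (I n) q) \<Longrightarrow>
   res (I n) p q x \<in> carrier (obj (I n) p)"
  using abelian_group_hom.hom_closed[OF hom_res] by blast

lemma differential_closed:
  "p \<in> P \<Longrightarrow> x \<in> carrier (obj (I n) p) \<Longrightarrow> \<delta> n p x \<in> carrier (obj (I (Suc n)) p)"
  using abelian_group_hom.hom_closed[OF hom_differential] by blast

lemma differential_differential:
  assumes "p \<in> P" "x \<in> carrier (obj (I n) p)"
  shows "\<delta> (Suc n) p (\<delta> n p x) = \<zero>\<^bsub>obj (I (Suc (Suc n))) p\<^esub>"
  using exact[OF assms(1), of n] assms(2) by (auto simp: a_kernel_def kernel_def)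

lemma exact_lift:
  assumes "p \<in> P" "x \<in> carrier (obj (I (Suc n)) p)" "\<delta> (Suc n) p x = \<zero>\<^bsub>obj (I (Suc (Suc n))) p\<^esub>"
  obtains z where "z \<in> carrier (obj (I n) p)" "\<delta> n p z = x"
proof -
  have "x \<in> \<delta> n p ` carrier (obj (I n) p)"
    using exact[OF assms(1), of n] assms(2,3) by (simp add: a_kernel_def kernel_def)
  then show ?thesis using that by blast
qed

lemma acyclic_in_empty: "acyclic_in k {}"
  by (auto simp: acyclic_in_def coboundary_def sections_on_def split: nat.split)

lemma cocycle_subset: "cocycle k D x \<Longrightarrow> D' \<subseteq> D \<Longrightarrow> cocycle k D' x"
  by (auto simp: cocycle_def sections_on_def subset_iff)

lemma cocycle_difference:
  assumes "D \<subseteq> P" "y \<in> sections_on (I k) D" "z \<in> sections_on (I k) D"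
    and "\<And>q. q \<in> D \<Longrightarrow> \<delta> k q (y q) = \<delta> k q (z q)"
  shows "cocycle k D (\<lambda>q. y q \<ominus>\<^bsub>obj (I k) q\<^esub> z q)"
proof -
  note DP = subsetD[OF assms(1)]
  have y: "y q \<in> carrier (obj (I k) q)" and z: "z q \<in> carrier (obj (I k) q)" if "q \<in> D" for q
    using assms(2,3) that by (auto simp: sections_on_def)
  let ?u = "\<lambda>q. y q \<ominus>\<^bsub>obj (I k) q\<^esub> z q"
  have "?u q \<in> carrier (obj (I k) q)" if "q \<in> D" for q
    using abelian_group.minus_closed[OF abelian_group_obj] y z that DP by metis
  moreover have "res (I k) p q (?u q) = ?u p" if "p \<in> D" "q \<in> D" "p \<le> q" for p q
  proof -
    interpret h: abelian_group_hom "obj (I k) q" "obj (I k) p" "res (I k) p q"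
      using that DP by (intro hom_res) auto
    have "res (I k) p q (y q) = y p" "res (I k) p q (z q) = z p"
      using assms(2,3) that by (auto simp: sections_on_def)
    then show ?thesis
      using that y z by (simp add: a_minus_def)
  qed
  moreover have "\<delta> k q (?u q) = \<zero>\<^bsub>obj (I (Suc k)) q\<^esub>" if "q \<in> D" for q
  proof -
    interpret h: abelian_group_hom "obj (I k) q" "obj (I (Suc k)) q" "\<delta> k q"
      using that DP by (intro hom_differential) auto
    show ?thesis
      using that assms(4) y z by (simp add: a_minus_def h.H.r_neg)
  qed
  ultimately show ?thesis by (simp add: cocycle_def sections_on_def)
qed

text \<open>
  This is the vanishing of relative cohomology in degree \<open>k + 1\<close> of the cone below \<open>t\<close> modulo \<open>D\<close>.
  It follows from the long exact sequence, as the cone has no cohomology in positive degrees: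
  exactness in \<open>t\<close> gives some primitive \<open>z\<close> of \<open>x\<close>, whose restriction to \<open>D\<close> differs from \<open>y\<close> by a
  cocycle of degree \<open>k\<close>; a primitive of this cocycle extends to \<open>t\<close> by flasqueness and corrects \<open>z\<close>.
\<close>
lemma cone_extension:
  assumes "t \<in> P" "lower_in P D" "D \<subseteq> {..t}" "acyclic_in k D"
    and "x \<in> carrier (obj (I (Suc k)) t)" "\<delta> (Suc k) t x = \<zero>\<^bsub>obj (I (Suc (Suc k))) t\<^esub>"
    and "y \<in> sections_on (I k) D" "\<And>q. q \<in> D \<Longrightarrow> \<delta> k q (y q) = res (I (Suc k)) q t x"
  shows "\<exists>v \<in> carrier (obj (I k) t). (\<forall>q\<in>D. res (I k) q t v = y q) \<and> \<delta> k t v = x"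
proof -
  obtain z where z: "z \<in> carrier (obj (I k) t)" "\<delta> k t z = x"
    using exact_lift[OF assms(1,5,6)] .
  have DP: "q \<in> P" "q \<le> t" if "q \<in> D" for q
    using assms(2,3) that by (auto simp: lower_in_def)
  have y: "y q \<in> carrier (obj (I k) q)" if "q \<in> D" for q
    using assms(7) that by (simp add: sections_on_def)
  let ?u = "\<lambda>q. y q \<ominus>\<^bsub>obj (I k) q\<^esub> res (I k) q t z"
  have "(\<lambda>q. res (I k) q t z) \<in> sections_on (I k) D"
    using DP assms(1) z by (auto simp: sections_on_def res_comp intro: res_closed)
  then have "cocycle k D ?u"
    using assms(1,7,8) DP z by (intro cocycle_difference) (auto simp: differential_res)
  then have cob: "coboundary k D ?u"
    using assms(4) by (simp add: acyclic_in_def)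
  have restore: "res (I k) q t z \<oplus>\<^bsub>obj (I k) q\<^esub> ?u q = y q" if "q \<in> D" for q
  proof -
    interpret abelian_group "obj (I k) q"
      using that DP by (intro abelian_group_obj)
    show ?thesis
      using that DP assms(1) z y by (simp add: a_minus_def a_ac res_closed r_neg1 r_neg2 r_neg)
  qed
  show ?thesis
  proof (cases k)
    case 0
    have "res (I k) q t z = y q" if "q \<in> D" for q
    proof -
      interpret abelian_group "obj (I k) q"
        using that DP by (intro abelian_group_obj)
      have "?u q = \<zero>\<^bsub>obj (I k) q\<^esub>"
        using cob 0 that by (simp add: coboundary_def)
      then show ?thesis
        using restore[OF that] that DP assms(1) z by (simp add: res_closed)
    qed
    then show ?thesis using z by blast
  next
    case (Suc j)
    then obtain w where w: "w \<in> sections_on (I j) D" "\<And>q. q \<in> D \<Longrightarrow> \<delta> j q (w q) = ?u q"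
      using cob by (auto simp: coboundary_def)
    obtain w' where w': "w' \<in> carrier (obj (I j) t)" "\<And>q. q \<in> D \<Longrightarrow> res (I j) q t w' = w q"
      using flasque[OF assms(1-3) w(1)] by blast
    let ?v = "z \<oplus>\<^bsub>obj (I k) t\<^esub> \<delta> j t w'"
    have dw': "\<delta> j t w' \<in> carrier (obj (I k) t)"
      using w' assms(1) Suc by (auto intro: differential_closed)
    interpret h: abelian_group_hom "obj (I k) t" "obj (I (Suc k)) t" "\<delta> k t"
      by (rule hom_differential[OF assms(1)])
    have "\<delta> k t (\<delta> j t w') = \<zero>\<^bsub>obj (I (Suc k)) t\<^esub>"
      using differential_differential[OF assms(1) w'(1)] Suc by simp
    then have "\<delta> k t ?v = x"
      using z dw' assms(5) by simp
    moreover have "res (I k) q t ?v = y q" if "q \<in> D" for q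
    proof -
      interpret r: abelian_group_hom "obj (I k) t" "obj (I k) q" "res (I k) q t"
        using that DP assms(1) by (intro hom_res)
      have "res (I k) q t ?v = res (I k) q t z \<oplus>\<^bsub>obj (I k) q\<^esub> res (I k) q t (\<delta> j t w')"
        using z dw' by simp
      also have "res (I k) q t (\<delta> j t w') = ?u q"
        using differential_res[of q t w' j] w' w(2) that DP assms(1) Suc by simp
      finally show ?thesis using restore[OF that] by simp
    qed
    ultimately show ?thesis using z(1) dw' by blast
  qed
qed

text \<open>
  The cocycle is integrated by recursion along the well-founded order: a primitive that is known
  strictly below \<open>p\<close> is extended to \<open>p\<close> by \<open>cone_extension\<close>. Making the extension pointwise, instead
  of proving vanishing up to each degree, covers posets of unbounded degree without an argument
  about inverse limits of complexes.
\<close>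
lemma acyclic_in_Suc:
  assumes "lower_in P D" "\<And>p. p \<in> D \<Longrightarrow> acyclic_in k (below p)"
  shows "acyclic_in (Suc k) D"
  unfolding acyclic_in_def
proof (intro allI impI)
  fix x assume "cocycle (Suc k) D x"
  then have x: "\<And>p. p \<in> D \<Longrightarrow> x p \<in> carrier (obj (I (Suc k)) p)"
    "\<And>p q. p \<in> D \<Longrightarrow> q \<in> D \<Longrightarrow> p \<le> q \<Longrightarrow> res (I (Suc k)) p q (x q) = x p"
    "\<And>p. p \<in> D \<Longrightarrow> \<delta> (Suc k) p (x p) = \<zero>\<^bsub>obj (I (Suc (Suc k))) p\<^esub>"
    by (auto simp: cocycle_def sections_on_def)
  have DP: "D \<subseteq> P" and low: "\<And>p q. p \<in> D \<Longrightarrow> q \<in> P \<Longrightarrow> q \<le> p \<Longrightarrow> q \<in> D"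
    using assms(1) by (auto simp: lower_in_def)
  \<comment> \<open>\<open>v\<close> is an admissible value at \<open>p\<close> for a primitive that is given by \<open>f\<close> strictly below \<open>p\<close>.\<close>
  define good where "good f p v \<longleftrightarrow> (p \<in> D \<longrightarrow>
      v \<in> carrier (obj (I k) p) \<and> (\<forall>q\<in>below p. res (I k) q p v = f q) \<and> \<delta> k p v = x p)"
    for f p v
  let ?r = "{(q, p). q \<in> P \<and> p \<in> P \<and> q < p}"
  have "?r \<subseteq> measure (degree P)"
    using degree_less[OF filtered] by auto
  then have wf: "wf ?r" using wf_subset wf_measure by blast
  have "\<exists>f. \<forall>p. good f p (f p)"
  proof (rule dependent_wf_choice[OF wf])
    show "good f p v = good g p v" if "\<And>q. (q, p) \<in> ?r \<Longrightarrow> f q = g q" for f g p v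
      using that DP by (auto simp: good_def)
  next
    fix p f assume IH: "\<And>q. (q, p) \<in> ?r \<Longrightarrow> good f q (f q)"
    show "\<exists>v. good f p v"
    proof (cases "p \<in> D")
      case True
      have g: "f q \<in> carrier (obj (I k) q)" "\<delta> k q (f q) = x q"
        "\<And>q'. q' \<in> P \<Longrightarrow> q' < q \<Longrightarrow> res (I k) q' q (f q) = f q'" if "q \<in> below p" for q
        using IH[of q] that True DP low[OF True] by (auto simp: good_def)
      have "res (I k) q' q (f q) = f q'" if "q \<in> below p" "q' \<in> P" "q' \<le> q" for q q'
        using g[OF that(1)] that res_refl by (cases "q' = q") auto
      then have "f \<in> sections_on (I k) (below p)"
        using g by (auto simp: sections_on_def)
      moreover have "lower_in P (below p)"
        by (auto simp: lower_in_def)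
      ultimately have "\<exists>v \<in> carrier (obj (I k) p).
          (\<forall>q\<in>below p. res (I k) q p v = f q) \<and> \<delta> k p v = x p"
        using True DP x assms(2) g(2) low[OF True]
        by (intro cone_extension) auto
      then show ?thesis by (auto simp: good_def)
    qed (simp add: good_def)
  qed
  then obtain f where f: "\<And>p. good f p (f p)" by blast
  have "res (I k) q p (f p) = f q" if "p \<in> D" "q \<in> D" "q \<le> p" for p q
    using f[of p] that DP res_refl by (cases "q = p") (auto simp: good_def)
  then have "f \<in> sections_on (I k) D"
    using f by (auto simp: sections_on_def good_def)
  moreover have "\<forall>p\<in>D. \<delta> k p (f p) = x p"
    using f by (simp add: good_def)
  ultimately show "coboundary (Suc k) D x"
    by (auto simp: coboundary_def)
qed

text \<open>
  A Mayer--Vietoris argument. The cones under the tips, together with \<open>L\<close>, cover \<open>Q\<close>, and two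
  different cones only meet inside \<open>L\<close>. So it suffices to integrate the cocycle on \<open>L\<close> and to extend
  the primitive to the tip of each cone separately; the obstruction to this lies in the cohomology
  of the intersection of the cone with \<open>L\<close>, one degree lower.
\<close>
lemma acyclic_in_union_cones:
  assumes "lower_in P Q" "lower_in P L" "L \<subseteq> Q"
    and apex: "\<And>q. q \<in> Q - L \<Longrightarrow> apex q \<in> Q - L" "\<And>q. q \<in> Q - L \<Longrightarrow> q \<le> apex q"
      "\<And>q q'. q \<in> Q - L \<Longrightarrow> q' \<in> Q - L \<Longrightarrow> q \<le> q' \<Longrightarrow> apex q = apex q'"
    and "acyclic_in (Suc k) L" "\<And>t. t \<in> Q - L \<Longrightarrow> acyclic_in k {q \<in> L. q \<le> t}"
  shows "acyclic_in (Suc k) Q"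
  unfolding acyclic_in_def
proof (intro allI impI)
  fix x assume cx: "cocycle (Suc k) Q x"
  then have x: "\<And>p. p \<in> Q \<Longrightarrow> x p \<in> carrier (obj (I (Suc k)) p)"
    "\<And>p q. p \<in> Q \<Longrightarrow> q \<in> Q \<Longrightarrow> p \<le> q \<Longrightarrow> res (I (Suc k)) p q (x q) = x p"
    "\<And>p. p \<in> Q \<Longrightarrow> \<delta> (Suc k) p (x p) = \<zero>\<^bsub>obj (I (Suc (Suc k))) p\<^esub>"
    by (auto simp: cocycle_def sections_on_def)
  have QP: "q \<in> P" if "q \<in> Q" for q
    using assms(1) that by (auto simp: lower_in_def)
  have low: "\<And>p q. p \<in> L \<Longrightarrow> q \<in> P \<Longrightarrow> q \<le> p \<Longrightarrow> q \<in> L"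
    using assms(2) by (auto simp: lower_in_def)
  have "coboundary (Suc k) L x"
    using assms(7) cocycle_subset[OF cx assms(3)] by (simp add: acyclic_in_def)
  then obtain y where "y \<in> sections_on (I k) L" and dy: "\<And>p. p \<in> L \<Longrightarrow> \<delta> k p (y p) = x p"
    by (auto simp: coboundary_def)
  then have y: "\<And>p. p \<in> L \<Longrightarrow> y p \<in> carrier (obj (I k) p)"
    "\<And>p q. p \<in> L \<Longrightarrow> q \<in> L \<Longrightarrow> p \<le> q \<Longrightarrow> res (I k) p q (y q) = y p"
    by (auto simp: sections_on_def)
  have "\<exists>v \<in> carrier (obj (I k) t).
      (\<forall>q\<in>{q \<in> L. q \<le> t}. res (I k) q t v = y q) \<and> \<delta> k t v = x t" if t: "t \<in> Q - L" for t
  proof (rule cone_extension)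
    show "lower_in P {q \<in> L. q \<le> t}"
      using assms(2) by (auto simp: lower_in_def)
    show "y \<in> sections_on (I k) {q \<in> L. q \<le> t}"
      using y by (auto simp: sections_on_def)
    show "\<delta> k q (y q) = res (I (Suc k)) q t (x t)" if "q \<in> {q \<in> L. q \<le> t}" for q
      using x(2)[of q t] dy[of q] t that assms(3) by auto
  qed (use t QP x assms(8) in auto)
  then obtain v where v: "\<And>t. t \<in> Q - L \<Longrightarrow> v t \<in> carrier (obj (I k) t)"
    "\<And>t q. t \<in> Q - L \<Longrightarrow> q \<in> L \<Longrightarrow> q \<le> t \<Longrightarrow> res (I k) q t (v t) = y q"
    "\<And>t. t \<in> Q - L \<Longrightarrow> \<delta> k t (v t) = x t"
    by (metis (mono_tags, lifting) mem_Collect_eq)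
  define u where "u q = (if q \<in> L then y q else res (I k) q (apex q) (v (apex q)))" for q
  have topP: "apex q \<in> P" "v (apex q) \<in> carrier (obj (I k) (apex q))" if "q \<in> Q - L" for q
    using that apex(1) v(1) QP by auto
  have "u q \<in> carrier (obj (I k) q)" if "q \<in> Q" for q
    using that y(1) topP apex(2) QP by (auto simp: u_def intro!: res_closed)
  moreover have "res (I k) p q (u q) = u p" if pq: "p \<in> Q" "q \<in> Q" "p \<le> q" for p q
  proof (cases "q \<in> L")
    case True
    then have "p \<in> L" using low QP pq by blast
    then show ?thesis using True y(2) pq by (simp add: u_def)
  next
    case False
    then have q: "q \<in> Q - L" using pq by simp
    have "res (I k) p q (u q) = res (I k) p (apex q) (v (apex q))"
      using False q pq QP topP[OF q] apex(2)[OF q] by (simp add: u_def res_comp)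
    also have "\<dots> = u p"
    proof (cases "p \<in> L")
      case True
      then show ?thesis
        using v(2)[OF apex(1)[OF q] True] apex(2)[OF q] pq by (simp add: u_def)
    next
      case False
      then show ?thesis using apex(3)[of p q] q pq by (simp add: u_def)
    qed
    finally show ?thesis .
  qed
  ultimately have "u \<in> sections_on (I k) Q"
    by (simp add: sections_on_def)
  moreover have "\<delta> k q (u q) = x q" if "q \<in> Q" for q
  proof (cases "q \<in> L")
    case False
    then have q: "q \<in> Q - L" using that by simp
    have "\<delta> k q (u q) = res (I (Suc k)) q (apex q) (x (apex q))"
      using False that QP topP[OF q] apex(1,2)[OF q] v(3) by (simp add: u_def differential_res)
    then show ?thesis using x(2)[of q "apex q"] that apex(1,2)[OF q] by simp
  qed (simp add: u_def dy)
  ultimately show "coboundary (Suc k) Q x"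
    by (auto simp: coboundary_def)
qed

section \<open>Vanishing above the labels\<close>

text \<open>
  If the label of \<open>p\<close> exceeds all labels below it, the induction hypothesis makes
  \<open>acyclic_in_Suc\<close> applicable to \<open>below p\<close>. That argument loses one degree when \<open>p\<close> inherits the
  maximal label \<open>m\<close>. Then, however, the elements with labels \<open>m - 1\<close> and \<open>m\<close> form a disjoint union
  of cones, so the cohomology of \<open>below p\<close> is controlled by the elements with smaller labels,
  where two degrees are available: one for integrating on \<open>L\<close>, one for the Mayer--Vietoris shift.
\<close>
lemma acyclic_in_below:
  assumes "p \<in> P" "labelling P p \<le> k"
  shows "acyclic_in k (below p)"
  using assms
proof (induction "degree P p" arbitrary: p k rule: less_induct)
  case less
  have IH: "acyclic_in j (below q)" if "q \<in> below p" "labelling P q \<le> j" for q j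
    using that less.prems(1) degree_less[OF filtered] by (intro less.hyps) auto
  have IH_Suc: "acyclic_in (Suc j) D"
    if "lower_in P D" "D \<subseteq> below p" "\<And>q. q \<in> D \<Longrightarrow> labelling P q \<le> j" for D j
    using that IH by (intro acyclic_in_Suc) auto
  have low: "lower_in P (below p)" by (auto simp: lower_in_def)
  from filtered less.prems(1) show ?case
  proof (cases rule: labelling_cases)
    case new
    show ?thesis
    proof (cases k)
      case 0
      then have "below p = {}" using new less.prems(2) by auto
      then show ?thesis using acyclic_in_empty by metis
    next
      case (Suc j)
      then show ?thesis
        using new less.prems(2) low by (fastforce intro: IH_Suc)
    qed
  next
    case inherited
    \<comment> \<open>So there is no claim about cohomology in degree \<open>0\<close>, which need not vanish.\<close>
    have "labelling P p > 0"
      using labelling_pos[OF filtered less.prems(1)] inherited(1) by simp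
    then obtain j where k: "k = Suc j"
      using less.prems(2) gr0_implies_Suc by fastforce
    define L where "L = {q \<in> below p. Suc (labelling P q) < labelling P p}"
    have L: "L \<subseteq> below p" by (auto simp: L_def)
    have lowL: "lower_in P L"
      using labelling_mono[OF filtered] by (force simp: lower_in_def L_def order.order_iff_strict)
    have U: "{s \<in> P. s < p \<and> labelling P p \<le> Suc (labelling P s)} = below p - L"
      by (auto simp: L_def)
    obtain apex where apex: "\<forall>q\<in>below p - L. apex q \<in> below p - L \<and> q \<le> apex q"
      "\<forall>q\<in>below p - L. \<forall>q'\<in>below p - L. q \<le> q' \<longrightarrow> apex q = apex q'"
      using no_circuit_apex[OF filtered less.prems(1) Diff_subset inherited(3)[unfolded U]]
      by (elim exE conjE)
    show ?thesis unfolding k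
    proof (rule acyclic_in_union_cones[OF low lowL L, of apex])
      show "apex q \<in> below p - L" "q \<le> apex q" if "q \<in> below p - L" for q
        using bspec[OF apex(1) that] by blast+
      show "apex q = apex q'" if "q \<in> below p - L" "q' \<in> below p - L" "q \<le> q'" for q q'
        using apex(2)[rule_format, OF that] .
    next
      show "acyclic_in (Suc j) L"
        using lowL L less.prems(2) k by (intro IH_Suc) (auto simp: L_def)
    next
      fix t assume "t \<in> below p - L"
      show "acyclic_in j {q \<in> L. q \<le> t}"
      proof (cases j)
        case 0
        \<comment> \<open>Here \<open>labelling P p = 1\<close>, and all elements below \<open>p\<close> lie in the cones.\<close>
        then have "L = {}" using less.prems(2) k by (auto simp: L_def)
        then show ?thesis by (simp add: acyclic_in_empty)
      next
        case (Suc i)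
        have "lower_in P {q \<in> L. q \<le> t}" using lowL by (auto simp: lower_in_def)
        then show ?thesis
          unfolding Suc using less.prems(2) k Suc by (intro IH_Suc) (auto simp: L_def)
      qed
    qed
  qed
qed

corollary acyclic_in_labelling:
  assumes "\<And>p. p \<in> P \<Longrightarrow> labelling P p \<le> k"
  shows "acyclic_in (Suc k) P"
  using assms by (intro acyclic_in_Suc acyclic_in_below) (auto simp: lower_in_def)

section \<open>Derived limits of acyclic posets\<close>

lemma cocycle_zero: "cocycle k P (\<lambda>p. \<zero>\<^bsub>obj (I k) p\<^esub>)"
proof -
  have "\<zero>\<^bsub>obj (I k) p\<^esub> \<in> carrier (obj (I k) p)"
    and "\<delta> k p \<zero>\<^bsub>obj (I k) p\<^esub> = \<zero>\<^bsub>obj (I (Suc k)) p\<^esub>" if "p \<in> P" for p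
  proof -
    interpret h: abelian_group_hom "obj (I k) p" "obj (I (Suc k)) p" "\<delta> k p"
      using that by (rule hom_differential)
    show "\<zero>\<^bsub>obj (I k) p\<^esub> \<in> carrier (obj (I k) p)"
      and "\<delta> k p \<zero>\<^bsub>obj (I k) p\<^esub> = \<zero>\<^bsub>obj (I (Suc k)) p\<^esub>" by simp_all
  qed
  moreover have "res (I k) p q \<zero>\<^bsub>obj (I k) q\<^esub> = \<zero>\<^bsub>obj (I k) p\<^esub>"
    if "p \<in> P" "q \<in> P" "p \<le> q" for p q
    using abelian_group_hom.hom_zero[OF hom_res[OF that]] .
  ultimately show ?thesis by (simp add: cocycle_def sections_on_def)
qed

lemma cocycle_add:
  assumes "cocycle k P x" "cocycle k P y"
  shows "cocycle k P (\<lambda>p. x p \<oplus>\<^bsub>obj (I k) p\<^esub> y p)"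
proof -
  \<comment> \<open>\<open>x + y = x - (0 - y)\<close> reduces sums to differences, which are covered already.\<close>
  let ?neg = "\<lambda>p. \<zero>\<^bsub>obj (I k) p\<^esub> \<ominus>\<^bsub>obj (I k) p\<^esub> y p"
  have neg: "cocycle k P ?neg"
    using cocycle_zero[of k] assms(2) by (intro cocycle_difference) (auto simp: cocycle_def)
  have "cocycle k P (\<lambda>p. x p \<ominus>\<^bsub>obj (I k) p\<^esub> ?neg p)"
    using neg assms(1) by (intro cocycle_difference) (auto simp: cocycle_def)
  moreover have "x p \<ominus>\<^bsub>obj (I k) p\<^esub> ?neg p = x p \<oplus>\<^bsub>obj (I k) p\<^esub> y p" if "p \<in> P" for p
  proof -
    interpret abelian_group "obj (I k) p" using that by (rule abelian_group_obj)
    show ?thesis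
      using that assms by (simp add: cocycle_def sections_on_def a_minus_def)
  qed
  ultimately show ?thesis by (auto simp: cocycle_def sections_on_def)
qed

lemma carrier_lim_iff:
  "x \<in> carrier (lim_module P (I k)) \<longleftrightarrow> x \<in> extensional P \<and> x \<in> sections_on (I k) P"
  by (auto simp: lim_module_def sections_on_def PiE_iff)

lemma kernel_lim_iff:
  "x \<in> a_kernel (lim_module P (I k)) (lim_module P (I (Suc k))) (lim_map P (\<delta> k)) \<longleftrightarrow>
   x \<in> extensional P \<and> cocycle k P x"
proof -
  have "lim_map P (\<delta> k) x = \<zero>\<^bsub>lim_module P (I (Suc k))\<^esub> \<longleftrightarrow>
      (\<forall>p\<in>P. \<delta> k p (x p) = \<zero>\<^bsub>obj (I (Suc k)) p\<^esub>)"
    by (auto simp: lim_map_def lim_module_def fun_eq_iff)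
  then show ?thesis
    by (auto simp: a_kernel_def kernel_def carrier_lim_iff cocycle_def)
qed

lemma coboundaries_lim:
  assumes "acyclic_in (Suc j) P"
  shows "coboundaries (\<lambda>n. lim_module P (I n)) (\<lambda>n. lim_map P (\<delta> n)) (Suc j) =
    a_kernel (lim_module P (I (Suc j))) (lim_module P (I (Suc (Suc j)))) (lim_map P (\<delta> (Suc j)))"
    (is "_ = ?K")
proof -
  have "lim_map P (\<delta> j) y \<in> ?K" if "y \<in> carrier (lim_module P (I j))" for y
  proof -
    have y: "y \<in> sections_on (I j) P" using that by (simp add: carrier_lim_iff)
    then have "cocycle (Suc j) P (lim_map P (\<delta> j) y)"
      by (auto simp: cocycle_def sections_on_def lim_map_def differential_closed
          differential_differential differential_res[symmetric])
    then show ?thesis by (simp add: kernel_lim_iff lim_map_def)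
  qed
  moreover have "x \<in> lim_map P (\<delta> j) ` carrier (lim_module P (I j))" if "x \<in> ?K" for x
  proof -
    have x: "x \<in> extensional P" "cocycle (Suc j) P x"
      using that by (simp_all add: kernel_lim_iff)
    then obtain y where y: "y \<in> sections_on (I j) P" "\<And>p. p \<in> P \<Longrightarrow> \<delta> j p (y p) = x p"
      using assms by (auto simp: acyclic_in_def coboundary_def)
    have "restrict y P \<in> carrier (lim_module P (I j))"
      using y(1) by (auto simp: carrier_lim_iff sections_on_def)
    moreover have "x = lim_map P (\<delta> j) (restrict y P)"
      using x(1) y(2) by (auto simp: lim_map_def extensional_def)
    ultimately show ?thesis by blast
  qed
  ultimately show ?thesis by (auto simp: coboundaries_def)
qed

text \<open>
  By acyclicity, the quotient is that of the cocycles by themselves. They are closed under sums and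
  differences, so there is a single coset.
\<close>
lemma derived_lim_trivial:
  assumes "acyclic_in (Suc j) P"
  shows "carrier (derived_lim P I \<delta> (Suc j)) = {\<zero>\<^bsub>derived_lim P I \<delta> (Suc j)\<^esub>}"
proof -
  let ?L = "lim_module P (I (Suc j))"
  define K where
    "K = a_kernel ?L (lim_module P (I (Suc (Suc j)))) (lim_map P (\<delta> (Suc j)))"
  have K: "x \<in> K \<longleftrightarrow> x \<in> extensional P \<and> cocycle (Suc j) P x" for x
    by (simp add: K_def kernel_lim_iff)
  have add: "x \<oplus>\<^bsub>?L\<^esub> y = (\<lambda>p\<in>P. x p \<oplus>\<^bsub>obj (I (Suc j)) p\<^esub> y p)" for x y
    by (simp add: lim_module_def)
  have restrict_K: "restrict x P \<in> K" if "cocycle (Suc j) P x" for x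
    using that by (auto simp: K cocycle_def sections_on_def)
  have coset: "(\<Union>h\<in>K. {h \<oplus>\<^bsub>?L\<^esub> a}) = K" if a: "a \<in> K" for a
  proof (intro subset_antisym subsetI)
    fix b assume "b \<in> (\<Union>h\<in>K. {h \<oplus>\<^bsub>?L\<^esub> a})"
    then obtain h where "h \<in> K" "b = h \<oplus>\<^bsub>?L\<^esub> a" by blast
    then show "b \<in> K"
      using a restrict_K[OF cocycle_add[of "Suc j" h a]] by (simp add: add K)
  next
    fix b assume b: "b \<in> K"
    let ?h = "\<lambda>p\<in>P. b p \<ominus>\<^bsub>obj (I (Suc j)) p\<^esub> a p"
    have "?h \<in> K"
      using a b by (intro restrict_K cocycle_difference) (auto simp: K cocycle_def)
    moreover have "b = ?h \<oplus>\<^bsub>?L\<^esub> a"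
    proof
      fix p
      show "b p = (?h \<oplus>\<^bsub>?L\<^esub> a) p"
      proof (cases "p \<in> P")
        case True
        interpret abelian_group "obj (I (Suc j)) p" using True by (rule abelian_group_obj)
        show ?thesis
          using True a b by (simp add: add K cocycle_def sections_on_def a_minus_def a_assoc l_neg)
      next
        case False
        then show ?thesis using b by (simp add: add K extensional_def)
      qed
    qed
    ultimately show "b \<in> (\<Union>h\<in>K. {h \<oplus>\<^bsub>?L\<^esub> a})" by blast
  qed
  have "K \<noteq> {}" using restrict_K[OF cocycle_zero] by blast
  then have "a_rcosets\<^bsub>?L\<lparr>carrier := K\<rparr>\<^esub> K = {K}"
    using coset by (auto simp: A_RCOSETS_def' a_r_coset_def')
  then show ?thesis
    by (simp add: derived_lim_def cohomology_def quotient_module_def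
        coboundaries_lim[OF assms] K_def)
qed

end

lemma flasque_resolution_of_injective_resolution:
  fixes I :: "nat \<Rightarrow> ('p::order, 'r, 'u) presheaf" and e :: "'r \<Rightarrow> 'u"
  assumes "cring R" "filtered P" "inj_on e (carrier R)" "injective_resolution R P F I \<epsilon> \<delta>"
  shows "flasque_resolution R P I \<delta>"
proof
  have inj: "injective_presheaf R P (I n)" for n
    using assms(4) by (simp add: injective_resolution_def)
  show "is_presheaf R P (I n)" for n
    using inj by (simp add: injective_presheaf_def)
  show "\<exists>x \<in> carrier (obj (I n) t). \<forall>q\<in>D. res (I n) q t x = s q"
    if "t \<in> P" "lower_in P D" "D \<subseteq> {..t}" "s \<in> sections_on (I n) D" for n t D s
    by (rule injective_presheaf_flasque[OF assms(1,3) inj that])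
qed (use assms in \<open>simp_all add: injective_resolution_def\<close>)

theorem theorem3p3:
  fixes R :: "('r, 'x) ring_scheme"
    and P :: "'p::order set"
    and F :: "('p, 'r, 'm) presheaf"
    and I :: "nat \<Rightarrow> ('p, 'r, ('p, 'r, 'm) univ) presheaf"
    and \<epsilon> :: "'p \<Rightarrow> 'm \<Rightarrow> ('p, 'r, 'm) univ"
    and \<delta> :: "nat \<Rightarrow> 'p \<Rightarrow> ('p, 'r, 'm) univ \<Rightarrow> ('p, 'r, 'm) univ"
    and k :: nat
  assumes "cring R"
    and "filtered P"
    and "is_presheaf R P F"
    and "injective_resolution R P F I \<epsilon> \<delta>"
    and "(SUP p\<in>P. enat (labelling P p)) < enat k"
  shows "carrier (derived_lim P I \<delta> k) = {\<zero>\<^bsub>derived_lim P I \<delta> k\<^esub>}"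
proof -
  \<comment> \<open>The indicator function of \<open>a\<close>, to embed the ring into the type of values of the resolution.\<close>
  let ?e = "\<lambda>a (p :: 'p, b, n :: nat). if b = a then UNIV :: 'm set else {}"
  have "inj_on ?e (carrier R)"
    by (auto simp: inj_on_def fun_eq_iff split: if_splits)
  then interpret flasque_resolution R P I \<delta>
    using flasque_resolution_of_injective_resolution[OF assms(1,2) _ assms(4)] by blast
  obtain j where k: "k = Suc j"
    using assms(5) by (cases k) (auto simp: enat_0)
  have "labelling P p \<le> j" if "p \<in> P" for p
    using SUP_upper[OF that, of "\<lambda>p. enat (labelling P p)"] assms(5) k
    by (metis enat_ord_simps(2) le_less_trans less_Suc_eq_le)
  then show ?thesis
    unfolding k by (intro derived_lim_trivial acyclic_in_labelling)
qed

end
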